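(* Let $T$ be a numerical semigroup with minimal system of generators $\operatorname{G}(T)=\{n_1,\ldots,n_r\}$, let $d\ge1$, and let $S=\{\mathbf{a}\in\mathbb{N}^d:|\mathbf{a}|\in T\}$ be the $T$-graded GNS. Then the minimal system of generators of $S$ is $\operatorname{G}(S)=\bigcup_{i=1}^rG_{n_i}$, where $G_k=\{\mathbf{x}\in\mathbb{N}^d:|\mathbf{x}|=k\}$.
   Context: $\mathbb{N}$ is the set of non-negative integers; $|\mathbf{x}|$ is the sum of the coordinates of $\mathbf{x}\in\mathbb{N}^d$. A GNS is a submonoid of $\mathbb{N}^d$ with finite complement; a numerical semigroup is the case $d=1$. Every GNS has a unique finite minimal system of generators (a monoid generating set no proper subset of which generates). *)

theory Defs
  imports "HOL-Analysis.Finite_Cartesian_Product"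
begin

definition add_submonoid :: "'a::comm_monoid_add set \<Rightarrow> bool" where
  "add_submonoid M \<longleftrightarrow> 0 \<in> M \<and> (\<forall>x\<in>M. \<forall>y\<in>M. x + y \<in> M)"

definition generates :: "'a::comm_monoid_add set \<Rightarrow> 'a set \<Rightarrow> bool" where
  "generates A S \<longleftrightarrow> add_submonoid hull A = S"

definition minimal_generating_system :: "'a::comm_monoid_add set \<Rightarrow> 'a set \<Rightarrow> bool" where
  "minimal_generating_system A S \<longleftrightarrow> generates A S \<and> (\<forall>B. B \<subset> A \<longrightarrow> \<not> generates B S)"

text \<open>This description is meaningful for submonoids of \<open>nat\<close> and of \<open>nat ^ 'd\<close>: see
  \<open>minimal_generators_nat\<close> and \<open>minimal_generators_vec\<close> below.\<close>

definition minimal_generators :: "'a::comm_monoid_add set \<Rightarrow> 'a set" where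
  "minimal_generators S = (THE A. minimal_generating_system A S)"

definition numerical_semigroup :: "nat set \<Rightarrow> bool" where
  "numerical_semigroup T \<longleftrightarrow> add_submonoid T \<and> finite (- T)"

definition gns :: "(nat ^ 'd::finite) set \<Rightarrow> bool" where
  "gns S \<longleftrightarrow> add_submonoid S \<and> finite (- S)"

definition coord_sum :: "nat ^ 'd::finite \<Rightarrow> nat" where
  "coord_sum x = (\<Sum>i\<in>UNIV. x $ i)"

definition graded_gns :: "nat set \<Rightarrow> (nat ^ 'd::finite) set" where
  "graded_gns T = {a. coord_sum a \<in> T}"

definition degree_layer :: "nat \<Rightarrow> (nat ^ 'd::finite) set" where
  "degree_layer k = {x. coord_sum x = k}"

lemma coord_sum_add: "coord_sum (x + y) = coord_sum x + coord_sum y"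
  by (simp add: coord_sum_def sum.distrib)

lemma coord_sum_eq_0: "coord_sum x = 0 \<Longrightarrow> x = 0"
  by (simp add: coord_sum_def vec_eq_iff)

lemma gns_graded_gns:
  assumes "numerical_semigroup T"
  shows "gns (graded_gns T :: (nat ^ 'd::finite) set)"
proof -
  have "add_submonoid (graded_gns T :: (nat ^ 'd) set)"
    using assms
    by (auto simp: numerical_semigroup_def add_submonoid_def graded_gns_def coord_sum_add)
       (simp add: coord_sum_def)
  moreover have "finite (- graded_gns T :: (nat ^ 'd) set)"
  proof -
    obtain N where N: "- T \<subseteq> {..N}"
      using assms finite_nat_iff_bounded_le by (auto simp: numerical_semigroup_def)
    have "x $ i \<le> N" if "x \<in> - graded_gns T" for x :: "nat ^ 'd" and i
    proof -
      have "x $ i \<le> coord_sum x"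
        unfolding coord_sum_def by (rule member_le_sum) auto
      moreover have "coord_sum x \<le> N"
        using that N by (auto simp: graded_gns_def)
      ultimately show ?thesis by linarith
    qed
    then have "vec_nth ` (- graded_gns T :: (nat ^ 'd) set) \<subseteq> (UNIV :: 'd set) \<rightarrow>\<^sub>E {..N}"
      by auto
    then have "finite (vec_nth ` (- graded_gns T :: (nat ^ 'd) set))"
      by (rule finite_subset) (simp add: finite_PiE)
    then show ?thesis
      by (rule finite_imageD) (simp add: inj_on_def vec_nth_inject)
  qed
  ultimately show ?thesis by (simp add: gns_def)
qed

lemma ex1_minimal_generating_system:
  fixes S :: "'a::comm_monoid_add set" and deg :: "'a \<Rightarrow> nat"
  assumes S: "add_submonoid S"
    and deg_add: "\<And>x y. deg (x + y) = deg x + deg y"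
    and deg_0: "\<And>x. deg x = 0 \<Longrightarrow> x = 0"
  shows "\<exists>!A. minimal_generating_system A S"
proof -
  define I where "I = {x\<in>S. x \<noteq> 0 \<and> (\<forall>y\<in>S. \<forall>z\<in>S. x = y + z \<longrightarrow> y = 0 \<or> z = 0)}"
  have I_le: "I \<subseteq> A" if "generates A S" for A
  proof -
    define M where "M = {x\<in>S. x \<in> I \<longrightarrow> x \<in> A}"
    have "A \<subseteq> S"
      using that hull_subset[of A add_submonoid] by (simp add: generates_def)
    then have "A \<subseteq> M" by (auto simp: M_def)
    moreover have "add_submonoid M"
      unfolding add_submonoid_def
    proof (intro conjI ballI)
      show "0 \<in> M" using S by (auto simp: M_def I_def add_submonoid_def)
    next
      fix x y assume x: "x \<in> M" and y: "y \<in> M"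
      then have "x + y \<in> S" using S by (auto simp: M_def add_submonoid_def)
      moreover have "x + y \<in> A" if "x + y \<in> I"
      proof -
        have "x = 0 \<or> y = 0" using that x y unfolding I_def M_def by blast
        then show ?thesis using that x y by (auto simp: M_def)
      qed
      ultimately show "x + y \<in> M" by (auto simp: M_def)
    qed
    ultimately have "add_submonoid hull A \<subseteq> M" by (rule hull_minimal)
    then show ?thesis using that by (auto simp: generates_def M_def I_def)
  qed
  have hull_I: "add_submonoid (add_submonoid hull I)"
    by (rule hull_in) (auto simp: add_submonoid_def)
  have "x \<in> add_submonoid hull I" if "x \<in> S" for x
    using that
  proof (induction "deg x" arbitrary: x rule: less_induct)
    case less
    consider "x = 0" | "x \<in> I" | y z where "y \<in> S" "z \<in> S" "x = y + z" "y \<noteq> 0" "z \<noteq> 0"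
      using less.prems by (auto simp: I_def)
    then show ?case
    proof cases
      case 1
      then show ?thesis using hull_I by (simp add: add_submonoid_def)
    next
      case 2
      then show ?thesis by (rule hull_inc)
    next
      case 3
      have "deg y \<noteq> 0" "deg z \<noteq> 0" using 3 deg_0 by blast+
      then have "deg y < deg x" "deg z < deg x" using deg_add[of y z] 3(3) by simp_all
      then have "y \<in> add_submonoid hull I" "z \<in> add_submonoid hull I"
        using less.hyps 3(1,2) by blast+
      then show ?thesis using hull_I 3(3) unfolding add_submonoid_def by blast
    qed
  qed
  moreover have "add_submonoid hull I \<subseteq> S"
    by (rule hull_minimal) (use S in \<open>auto simp: I_def\<close>)
  ultimately have gen_I: "generates I S" by (auto simp: generates_def)
  show ?thesis
  proof (rule ex1I[of _ I])
    show "minimal_generating_system I S"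
      using gen_I I_le unfolding minimal_generating_system_def by blast
  next
    fix A assume "minimal_generating_system A S"
    then show "A = I"
      using gen_I I_le unfolding minimal_generating_system_def by blast
  qed
qed

lemma minimal_generators_nat:
  fixes S :: "nat set"
  assumes "add_submonoid S"
  shows "minimal_generating_system A S \<longleftrightarrow> A = minimal_generators S"
proof -
  have ex1: "\<exists>!A. minimal_generating_system A S"
    by (rule ex1_minimal_generating_system[OF assms, of "\<lambda>x. x"]) auto
  show ?thesis
    unfolding minimal_generators_def using ex1 by (metis (no_types, lifting) theI')
qed

lemma minimal_generators_vec:
  fixes S :: "(nat ^ 'd::finite) set"
  assumes "add_submonoid S"
  shows "minimal_generating_system A S \<longleftrightarrow> A = minimal_generators S"
proof -
  have ex1: "\<exists>!A. minimal_generating_system A S"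
    by (rule ex1_minimal_generating_system[OF assms, of coord_sum])
       (auto simp: coord_sum_add coord_sum_eq_0)
  show ?thesis
    unfolding minimal_generators_def using ex1 by (metis (no_types, lifting) theI')
qed

end

theory Submission
  imports Defs
begin

text \<open>
  A vector of degree \<open>a + b\<close> splits into vectors of degrees \<open>a\<close> and \<open>b\<close>, so any decomposition of
  \<open>|x|\<close> into generators of \<open>T\<close> lifts to a decomposition of \<open>x\<close>; hence the layers generate \<open>S\<close>.
  Conversely a minimal generator \<open>n\<close> of \<open>T\<close> is irreducible in \<open>T\<close>, so every \<open>x\<close> with \<open>|x| = n\<close> is
  irreducible in \<open>S\<close>, that is, \<open>S - {x}\<close> is again a submonoid, and \<open>x\<close> cannot be omitted.
\<close>

lemma add_submonoid_hull: "add_submonoid (add_submonoid hull A)"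
  by (rule hull_in) (auto simp: add_submonoid_def)

text \<open>By minimality \<open>a\<close> lies outside the hull \<open>H\<close> of the other
  generators, for otherwise \<open>H\<close> would contain all of \<open>A\<close> and hence equal
  \<open>S\<close>. If \<open>a\<close> were a sum of two nonzero elements of \<open>S\<close>, both
  would have smaller degree, hence lie in \<open>H\<close>, and \<open>a\<close> with them.\<close>

lemma minimal_generator_irreducible:
  fixes S :: "'a::comm_monoid_add set" and deg :: "'a \<Rightarrow> nat"
  assumes deg_add: "\<And>x y. deg (x + y) = deg x + deg y"
    and deg_0: "\<And>x. deg x = 0 \<Longrightarrow> x = 0"
    and A: "minimal_generating_system A S" and a: "a \<in> A"
  shows "a \<noteq> 0" and "\<lbrakk>y \<in> S; z \<in> S; a = y + z\<rbrakk> \<Longrightarrow> y = 0 \<or> z = 0"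
proof -
  define H where "H = add_submonoid hull (A - {a})"
  have H: "add_submonoid H" unfolding H_def by (rule add_submonoid_hull)
  have gen: "add_submonoid hull A = S" and "\<not> generates (A - {a}) S"
    using A a unfolding minimal_generating_system_def generates_def by blast+
  then have "H \<noteq> S" by (simp add: generates_def H_def)
  have a_notin: "a \<notin> H"
  proof
    assume "a \<in> H"
    then have "A \<subseteq> H" unfolding H_def using hull_subset[of "A - {a}" add_submonoid] by blast
    then have "S \<subseteq> H" using H hull_minimal[of A H add_submonoid] gen by simp
    moreover have "H \<subseteq> S" unfolding H_def gen[symmetric] by (rule hull_mono) blast
    ultimately show False using \<open>H \<noteq> S\<close> by blast
  qed
  then show "a \<noteq> 0" using H by (auto simp: add_submonoid_def)
  have small: "x \<in> H" if "x \<in> S" "deg x < deg a" for x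
  proof -
    \<comment> \<open>The condition is vacuous at \<open>a\<close> itself, and it is stable under
      sums because the summands of an element of small degree have small degree too.\<close>
    have "A \<subseteq> {x. deg x < deg a \<longrightarrow> x \<in> H}"
      unfolding H_def using hull_subset[of "A - {a}" add_submonoid] by blast
    moreover have "add_submonoid {x. deg x < deg a \<longrightarrow> x \<in> H}"
      using H by (auto simp: add_submonoid_def deg_add)
    ultimately have "add_submonoid hull A \<subseteq> {x. deg x < deg a \<longrightarrow> x \<in> H}"
      by (rule hull_minimal)
    then show ?thesis using that gen by blast
  qed
  assume yz: "y \<in> S" "z \<in> S" "a = y + z"
  show "y = 0 \<or> z = 0"
  proof (rule ccontr)
    assume "\<not> (y = 0 \<or> z = 0)"
    then have "deg y \<noteq> 0" "deg z \<noteq> 0" using deg_0 by blast+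
    then have "y \<in> H" "z \<in> H" using small yz by (simp_all add: deg_add)
    then show False using a_notin H yz(3) by (auto simp: add_submonoid_def)
  qed
qed

lemma coord_sum_zero [simp]: "coord_sum 0 = 0"
  by (simp add: coord_sum_def)

text \<open>Start with \<open>0\<close> and \<open>x\<close>, then move one unit vector at a time
  from the second summand to the first.\<close>

lemma coord_sum_split:
  fixes x :: "nat ^ 'd::finite"
  assumes "coord_sum x = a + b"
  obtains y z where "x = y + z" "coord_sum y = a" "coord_sum z = b"
proof -
  have "\<exists>y z. x = y + z \<and> coord_sum y = a \<and> coord_sum z = b"
    using assms
  proof (induction a arbitrary: b)
    case 0
    then show ?case by (intro exI[of _ 0] exI[of _ x]) simp
  next
    case (Suc a)
    \<comment> \<open>The induction hypothesis is taken at \<open>Suc b\<close>, so that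
      \<open>z\<close> still has a unit to give away.\<close>
    then obtain y z where yz: "x = y + z" "coord_sum y = a" "coord_sum z = Suc b"
      by (metis add_Suc_shift)
    then obtain i where i: "z $ i \<noteq> 0"
      by (metis coord_sum_def sum.neutral nat.distinct(1))
    define e :: "nat ^ 'd" where "e = axis i 1"
    have e: "coord_sum e = 1" by (simp add: e_def coord_sum_def axis_def)
    \<comment> \<open>Subtraction on \<open>nat\<close> truncates; the choice of \<open>i\<close>
      makes it exact here.\<close>
    have z: "z = e + (z - e)" using i by (simp add: vec_eq_iff e_def axis_def)
    then have "coord_sum (z - e) = b"
      using yz(3) e coord_sum_add[of e "z - e"] by simp
    moreover have "x = (y + e) + (z - e)" using yz(1) z by (simp add: add.assoc)
    ultimately show ?case using yz(2) e
      by (intro exI[of _ "y + e"] exI[of _ "z - e"]) (simp add: coord_sum_add)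
  qed
  then show thesis using that by blast
qed

lemma minimal_generators_graded_gns:
  assumes T: "add_submonoid T"
  shows "minimal_generators (graded_gns T :: (nat ^ 'd::finite) set) =
    (\<Union>k\<in>minimal_generators T. degree_layer k)"
proof -
  define S :: "(nat ^ 'd) set" where "S = graded_gns T"
  define G where "G = minimal_generators T"
  define U :: "(nat ^ 'd) set" where "U = (\<Union>k\<in>G. degree_layer k)"
  have S: "add_submonoid S"
    using T by (auto simp: S_def graded_gns_def add_submonoid_def coord_sum_add)
  have G: "minimal_generating_system G T"
    using minimal_generators_nat[OF T] by (simp add: G_def)
  then have gen: "add_submonoid hull G = T"
    by (simp add: minimal_generating_system_def generates_def)
  then have "G \<subseteq> T" using hull_subset[of G add_submonoid] by simp
  then have "U \<subseteq> S" by (auto simp: U_def S_def graded_gns_def degree_layer_def)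
  have "generates U S"
    unfolding generates_def
  proof
    show "add_submonoid hull U \<subseteq> S" using \<open>U \<subseteq> S\<close> S by (rule hull_minimal)
  next
    \<comment> \<open>Collecting the degrees whose whole layer is generated moves the question into
      \<open>nat\<close>: once \<open>K\<close> is a submonoid containing \<open>G\<close>, it
      contains \<open>T\<close>.\<close>
    define K where "K = {k. (degree_layer k :: (nat ^ 'd) set) \<subseteq> add_submonoid hull U}"
    have "G \<subseteq> K"
      using hull_subset[of U add_submonoid] by (auto simp: K_def U_def)
    moreover have "add_submonoid K"
      unfolding add_submonoid_def
    proof (intro conjI ballI)
      show "0 \<in> K"
        using add_submonoid_hull[of U]
        by (auto simp: K_def degree_layer_def add_submonoid_def dest!: coord_sum_eq_0)
    next
      fix a b assume "a \<in> K" "b \<in> K"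
      then show "a + b \<in> K"
        using add_submonoid_hull[of U]
        by (auto simp: K_def degree_layer_def add_submonoid_def elim!: coord_sum_split)
    qed
    ultimately have "T \<subseteq> K" using hull_minimal[of G K add_submonoid] gen by simp
    then show "S \<subseteq> add_submonoid hull U"
      by (auto simp: S_def graded_gns_def K_def degree_layer_def)
  qed
  moreover have "\<not> generates B S" if BU: "B \<subset> U" for B
  proof
    assume "generates B S"
    obtain x where x: "x \<in> U" "x \<notin> B" using BU by blast
    then have xG: "coord_sum x \<in> G" by (auto simp: U_def degree_layer_def)
    \<comment> \<open>In \<open>T\<close> each number serves as its own degree.\<close>
    note irr = minimal_generator_irreducible[of "\<lambda>k. k", OF _ _ G xG, simplified]
    have "add_submonoid (S - {x})"
      unfolding add_submonoid_def
    proof (intro conjI ballI)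
      show "0 \<in> S - {x}" using S irr(1) by (auto simp: add_submonoid_def)
    next
      fix y z assume yz: "y \<in> S - {x}" "z \<in> S - {x}"
      have "x \<noteq> y + z"
      proof
        \<comment> \<open>Taking degrees splits \<open>coord_sum x\<close> inside \<open>T\<close>,
          so one summand has degree 0 and vanishes; the other is then \<open>x\<close>, which was
          removed.\<close>
        assume "x = y + z"
        then have "y = 0 \<or> z = 0"
          using irr(2)[of "coord_sum y" "coord_sum z"] yz coord_sum_eq_0
          by (auto simp: S_def graded_gns_def coord_sum_add)
        then show False using \<open>x = y + z\<close> yz by auto
      qed
      then show "y + z \<in> S - {x}" using S yz by (auto simp: add_submonoid_def)
    qed
    moreover have "B \<subseteq> S - {x}" using BU x \<open>U \<subseteq> S\<close> by blast
    ultimately have "add_submonoid hull B \<subseteq> S - {x}" by (intro hull_minimal)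
    then show False using \<open>generates B S\<close> x \<open>U \<subseteq> S\<close> by (auto simp: generates_def)
  qed
  ultimately have "minimal_generating_system U S"
    by (simp add: minimal_generating_system_def)
  then have "U = minimal_generators S" using minimal_generators_vec[OF S] by simp
  then show ?thesis by (simp add: U_def S_def G_def)
qed

theorem theorem4p3:
  fixes T :: "nat set" and n :: "nat \<Rightarrow> nat" and r :: nat
    and S :: "(nat ^ 'd::finite) set"
  assumes "numerical_semigroup T"
    and "minimal_generators T = n ` {1..r}"
    and "S = graded_gns T"
  shows "minimal_generators S = (\<Union>i\<in>{1..r}. degree_layer (n i))"
  using assms minimal_generators_graded_gns[of T]
  by (simp add: numerical_semigroup_def)

end
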